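(* Let $\Psi:\mathbb{N}\to\mathbb{R}$ satisfy $\Psi(1)=1$, $\Psi(n)\nearrow\infty$ and $\Psi(n)/n\to 0$ as $n\to\infty$. If $$\lim_{n\to\infty}\frac{\Psi(2n)}{\Psi(n)}=1,$$ then there exists a non-zero symmetric continuous linear functional $\gamma:m_\Psi\to\mathbb{R}$.
   Context: $\Psi(n)\nearrow\infty$ means that $\Psi$ is increasing and tends to infinity. For a bounded real sequence $x=(x_n)_n$, its decreasing rearrangement $x^{*}=(x_n^{*})_n$ is $x_n^{*}=\inf\{\sup_{k\in\mathbb{N}\setminus J}|x_k| : J\subset\mathbb{N},\ \operatorname{card}J<n\}$. The (real) Marcinkiewicz sequence space associated to $\Psi$ is the space $m_\Psi$ of all bounded sequences $x\in\mathbb{R}^{\mathbb{N}}$ such that $\|x\|_{m_\Psi}=\sup_{n\in\mathbb{N}}\frac{\sum_{k=1}^{n}x_k^{*}}{\Psi(n)}<\infty$, with the norm $\|\cdot\|_{m_\Psi}$. For a permutation (bijection) $\sigma$ of $\mathbb{N}$, $x_\sigma=(x_{\sigma(n)})_n$. A functional $\gamma:m_\Psi\to\mathbb{R}$ is symmetric if $\gamma(x)=\gamma(x_\sigma)$ for every $x\in m_\Psi$ and every permutation $\sigma$ of $\mathbb{N}$. *)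

theory Defs
  imports "HOL-Analysis.Analysis"
begin

text \<open>
  The mathematical index set is \<open>{1, 2, 3, ...}\<close>.  A sequence is a function
  \<open>x :: nat \<Rightarrow> real\<close> whose value \<open>x k\<close> stands for the term with index \<open>k + 1\<close>.
  The rearrangement \<open>decr_rearr x n\<close> and the weight \<open>\<Psi> n\<close> keep the original indexing
  and are only used for \<open>n \<ge> 1\<close>.
\<close>

text \<open>
  Finiteness of \<open>J\<close> has to be required since \<open>card\<close> is 0 on infinite sets.
\<close>
definition decr_rearr :: "(nat \<Rightarrow> real) \<Rightarrow> nat \<Rightarrow> real" where
  "decr_rearr x n = (INF J\<in>{J. finite J \<and> card J < n}. SUP k\<in>UNIV - J. \<bar>x k\<bar>)"

definition marc_quot :: "(nat \<Rightarrow> real) \<Rightarrow> (nat \<Rightarrow> real) \<Rightarrow> nat \<Rightarrow> real" where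
  "marc_quot \<Psi> x n = (\<Sum>k=1..n. decr_rearr x k) / \<Psi> n"

definition marc_space :: "(nat \<Rightarrow> real) \<Rightarrow> (nat \<Rightarrow> real) set" where
  "marc_space \<Psi> = {x. bounded (range x) \<and> bdd_above (marc_quot \<Psi> x ` {1..})}"

text \<open>Meaningful on \<open>marc_space \<Psi>\<close> only, where the supremum is finite.\<close>
definition marc_norm :: "(nat \<Rightarrow> real) \<Rightarrow> (nat \<Rightarrow> real) \<Rightarrow> real" where
  "marc_norm \<Psi> x = (SUP n\<in>{1..}. marc_quot \<Psi> x n)"

text \<open>
  A functional on \<open>marc_space \<Psi>\<close> is a total function of which only the values on
  \<open>marc_space \<Psi>\<close> matter.
\<close>
definition marc_linear :: "(nat \<Rightarrow> real) \<Rightarrow> ((nat \<Rightarrow> real) \<Rightarrow> real) \<Rightarrow> bool" where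
  "marc_linear \<Psi> \<gamma> \<longleftrightarrow>
     (\<forall>x\<in>marc_space \<Psi>. \<forall>y\<in>marc_space \<Psi>. \<gamma> (\<lambda>k. x k + y k) = \<gamma> x + \<gamma> y) \<and>
     (\<forall>c. \<forall>x\<in>marc_space \<Psi>. \<gamma> (\<lambda>k. c * x k) = c * \<gamma> x)"

definition marc_continuous :: "(nat \<Rightarrow> real) \<Rightarrow> ((nat \<Rightarrow> real) \<Rightarrow> real) \<Rightarrow> bool" where
  "marc_continuous \<Psi> \<gamma> \<longleftrightarrow>
     (\<forall>x\<in>marc_space \<Psi>. \<forall>\<epsilon>>0. \<exists>\<delta>>0. \<forall>y\<in>marc_space \<Psi>.
        marc_norm \<Psi> (\<lambda>k. y k - x k) < \<delta> \<longrightarrow> \<bar>\<gamma> y - \<gamma> x\<bar> < \<epsilon>)"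

definition marc_symmetric :: "(nat \<Rightarrow> real) \<Rightarrow> ((nat \<Rightarrow> real) \<Rightarrow> real) \<Rightarrow> bool" where
  "marc_symmetric \<Psi> \<gamma> \<longleftrightarrow> (\<forall>x\<in>marc_space \<Psi>. \<forall>\<sigma>. bij \<sigma> \<longrightarrow> \<gamma> x = \<gamma> (x \<circ> \<sigma>))"

end

theory Submission
  imports Defs
begin

text \<open>
  The functional is a Dixmier trace.  Write \<open>S\<^sub>n(x)\<close> for the sum of the first \<open>n\<close> terms of the
  decreasing rearrangement of \<open>x\<close>.  This is the supremum of \<open>\<Sum>k\<in>J. \<bar>x k\<bar>\<close> over the sets \<open>J\<close> with at
  most \<open>n\<close> elements, so \<open>S\<^sub>n(x + y) \<le> S\<^sub>n(x) + S\<^sub>n(y) \<le> S\<^sub>2\<^sub>n(x + y)\<close> for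
  non-negative \<open>x\<close> and \<open>y\<close>: for the second inequality, the union of two sets with at most \<open>n\<close> elements has at most \<open>2n\<close> elements.  Hence
  \<open>S\<^sub>n(x) / \<Psi>(n)\<close> would become additive on the positive cone in a limit that does not distinguish
  \<open>n\<close> from \<open>2n\<close>.  Such a limit is obtained by restricting to \<open>n = 2^i\<close> and applying a Banach limit,
  because doubling \<open>n\<close> is then a shift of \<open>i\<close>, and because \<open>\<Psi>(2n) / \<Psi>(n) \<rightarrow> 1\<close> allows
  \<open>\<Psi>(n)\<close> to be replaced by \<open>\<Psi>(2n)\<close> in the denominator.  Positivity gives the bound by the norm, and
  permutations do not change \<open>S\<^sub>n\<close>.  The functional extends to signed sequences by differences of
  positive and negative parts.

  It is non-zero because some non-negative sequence has \<open>S\<^sub>n\<close> of the same size as \<open>\<Psi>(n)\<close>.  Sums of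
  decreasing sequences are concave in \<open>n\<close> and \<open>\<Psi>\<close> need not be, so the sequence is taken to be the
  increments of a concave majorant of \<open>\<Psi>\<close>, the infimum of all increasing affine majorants.  It is at
  most a constant times \<open>\<Psi>\<close>: the doubling condition implies that \<open>\<Psi>(m) / m \<le> 2 \<Psi>(n) / n\<close> for \<open>m \<ge> n\<close> and
  large \<open>n\<close>, so the line \<open>m \<mapsto> 2 \<Psi>(n) / n * m + \<Psi>(n)\<close> dominates \<open>\<Psi>\<close>, and
  its value at \<open>n\<close> is \<open>3 \<Psi>(n)\<close>.  The two halves are \<open>pos_trace_add\<close> with
  \<open>banach_limit_exists\<close>, and \<open>exists_rearr_sum_comparable\<close>.
\<close>

section \<open>Banach limits\<close>

text \<open>
  Tychonoff's theorem: the functions \<open>f n\<close> lie in a product of compact intervals, so they have a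
  cluster point in the topology of pointwise convergence.  It inherits every closed property that
  the \<open>f n\<close> have from some \<open>n\<close> on, and this is how it will be used.
\<close>
lemma pointwise_cluster_point:
  fixes f :: "nat \<Rightarrow> 'a \<Rightarrow> real"
  assumes "\<And>x. Bseq (\<lambda>n. f n x)"
  obtains g where
    "\<And>C. closed C \<Longrightarrow> eventually (\<lambda>n. f n \<in> C) sequentially \<Longrightarrow> g \<in> C"
proof -
  have "\<exists>B. \<forall>n. \<bar>f n x\<bar> \<le> B" for x
    using assms[of x] by (auto simp: Bseq_def)
  then obtain B where B: "\<And>x n. \<bar>f n x\<bar> \<le> B x"
    by metis
  define K where "K = PiE UNIV (\<lambda>x. cball (0::real) (B x))"
  have "compactin (product_topology (\<lambda>x::'a. euclidean) UNIV) K"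
    unfolding K_def by (simp add: compactin_PiE)
  then have "compact K"
    by (simp add: euclidean_product_topology)
  define F where "F = filtermap f sequentially"
  have "F \<noteq> bot"
    by (simp add: F_def filtermap_bot_iff)
  moreover have "eventually (\<lambda>h. h \<in> K) F"
    using B by (auto simp: F_def eventually_filtermap K_def intro!: always_eventually)
  ultimately obtain g where g: "inf (nhds g) F \<noteq> bot"
    using \<open>compact K\<close> unfolding compact_filter by blast
  show thesis
  proof
    fix C assume "closed C" and ev: "eventually (\<lambda>n. f n \<in> C) sequentially"
    show "g \<in> C"
    proof (rule ccontr)
      assume "g \<notin> C"
      then have "eventually (\<lambda>h. h \<notin> C) (nhds g)"
        using \<open>closed C\<close> eventually_nhds[of "\<lambda>h. h \<notin> C" g] by (auto simp: closed_def)
      moreover have "eventually (\<lambda>h. h \<in> C) F"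
        using ev by (simp add: F_def eventually_filtermap)
      ultimately have "eventually (\<lambda>h. False) (inf (nhds g) F)"
        unfolding eventually_inf by blast
      then show False
        using g by (simp add: trivial_limit_def)
    qed
  qed
qed

text \<open>
  A functional on bounded sequences, encoded as a total function of which only the values on bounded
  sequences matter.
\<close>
locale banach_limit =
  fixes L :: "(nat \<Rightarrow> real) \<Rightarrow> real"
  assumes add: "Bseq a \<Longrightarrow> Bseq b \<Longrightarrow> L (\<lambda>n. a n + b n) = L a + L b"
    and scale: "Bseq a \<Longrightarrow> L (\<lambda>n. c * a n) = c * L a"
    and nonneg: "Bseq a \<Longrightarrow> (\<And>n. 0 \<le> a n) \<Longrightarrow> 0 \<le> L a"
    and const_one: "L (\<lambda>n. 1) = 1"
    and shift: "Bseq a \<Longrightarrow> L (\<lambda>n. a (Suc n)) = L a"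

lemma Bseq_plus:
  fixes a b :: "nat \<Rightarrow> 'a::real_normed_vector"
  assumes "Bseq a" "Bseq b"
  shows "Bseq (\<lambda>n. a n + b n)"
proof -
  obtain A B where "\<And>n. norm (a n) \<le> A" "\<And>n. norm (b n) \<le> B"
    using assms by (auto simp: Bseq_def)
  then show ?thesis
    by (intro BseqI'[of _ "A + B"]) (meson add_mono norm_triangle_le)
qed

text \<open>
  A cluster point of the averaging functionals works: each of them is linear, positive and
  normalised, and shifting a bounded sequence changes its \<open>N\<close>-th average by \<open>O(1/N)\<close> only.
\<close>
lemma banach_limit_exists: "\<exists>L. banach_limit L"
proof -
  define f :: "nat \<Rightarrow> (nat \<Rightarrow> real) \<Rightarrow> real" where
    "f N a = (if Bseq a then (\<Sum>i<Suc N. a i) / Suc N else 0)" for N a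
  have bound: "\<bar>f N a\<bar> \<le> B" if "\<And>n. \<bar>a n\<bar> \<le> B" "Bseq a" for N a B
  proof -
    have "\<bar>\<Sum>i<Suc N. a i\<bar> \<le> real (Suc N) * B"
      using sum_bounded_above[of "{..<Suc N}" "\<lambda>i. \<bar>a i\<bar>" B] that(1)
        sum_abs[of a "{..<Suc N}"] by auto
    then show ?thesis
      using that(2) by (simp add: f_def field_simps del: sum.lessThan_Suc)
  qed
  \<comment> \<open>The value 0 on unbounded sequences makes the functionals pointwise bounded everywhere.\<close>
  have "Bseq (\<lambda>N. f N a)" for a
  proof (cases "Bseq a")
    case True
    then obtain B where "\<And>n. \<bar>a n\<bar> \<le> B"
      by (auto simp: Bseq_def)
    then show ?thesis
      using bound[OF _ True] by (intro BseqI'[of _ B]) auto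
  qed (simp add: f_def)
  then obtain L where L:
    "\<And>C. closed C \<Longrightarrow> eventually (\<lambda>n. f n \<in> C) sequentially \<Longrightarrow> L \<in> C"
    using pointwise_cluster_point[of f] by metis
  have "banach_limit L"
  proof
    fix a b :: "nat \<Rightarrow> real" assume ab: "Bseq a" "Bseq b"
    have "L \<in> {g. g (\<lambda>n. a n + b n) = g a + g b}"
      using ab by (intro L closed_Collect_eq continuous_intros)
        (auto simp: f_def Bseq_plus sum.distrib add_divide_distrib intro!: always_eventually)
    then show "L (\<lambda>n. a n + b n) = L a + L b" by simp
  next
    fix a :: "nat \<Rightarrow> real" and c assume a: "Bseq a"
    have "Bseq (\<lambda>n. c * a n)"
      using Bseq_mult[of "\<lambda>_. c" a] a by simp
    then have "L \<in> {g. g (\<lambda>n. c * a n) = c * g a}"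
      using a by (intro L closed_Collect_eq continuous_intros)
        (auto simp: f_def sum_distrib_left algebra_simps intro!: always_eventually)
    then show "L (\<lambda>n. c * a n) = c * L a" by simp
  next
    fix a :: "nat \<Rightarrow> real" assume a: "Bseq a" "\<And>n. 0 \<le> a n"
    have "L \<in> {g. 0 \<le> g a}"
      using a by (intro L closed_Collect_le continuous_intros)
        (auto simp: f_def intro!: always_eventually divide_nonneg_nonneg sum_nonneg add_nonneg_nonneg)
    then show "0 \<le> L a" by simp
  next
    have "L \<in> {g. g (\<lambda>n. 1) = 1}"
      by (intro L closed_Collect_eq continuous_intros) (auto simp: f_def intro!: always_eventually)
    then show "L (\<lambda>n. 1) = 1" by simp
  next
    fix a :: "nat \<Rightarrow> real" assume a: "Bseq a"
    then obtain B where B: "\<And>n. \<bar>a n\<bar> \<le> B"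
      by (auto simp: Bseq_def)
    have a': "Bseq (\<lambda>n. a (Suc n))"
      using B by (intro BseqI'[of _ B]) auto
    have diff: "\<bar>f N (\<lambda>n. a (Suc n)) - f N a\<bar> \<le> 2 * B / Suc N" for N
    proof -
      have "f N (\<lambda>n. a (Suc n)) - f N a = (a (Suc N) - a 0) / Suc N"
        using a a' by (simp add: f_def diff_divide_distrib[symmetric] sum_subtractf[symmetric]
            sum_lessThan_telescope del: sum.lessThan_Suc)
      also have "\<bar>\<dots>\<bar> \<le> 2 * B / Suc N"
        using B[of "Suc N"] B[of 0] by (auto simp: abs_le_iff intro!: divide_right_mono)
      finally show ?thesis .
    qed
    have lim: "(\<lambda>N. 2 * B / real (Suc N)) \<longlonglongrightarrow> 0"
      using tendsto_mult_right_zero[OF LIMSEQ_inverse_real_of_nat, of "2 * B"] 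
      by (simp add: field_simps)
    have "\<bar>L (\<lambda>n. a (Suc n)) - L a\<bar> \<le> \<epsilon>" if "\<epsilon> > 0" for \<epsilon>
    proof -
      have "eventually (\<lambda>N. 2 * B / real (Suc N) < \<epsilon>) sequentially"
        using order_tendstoD(2)[OF lim that] .
      then have "eventually (\<lambda>N. f N \<in> {g. \<bar>g (\<lambda>n. a (Suc n)) - g a\<bar> \<le> \<epsilon>}) sequentially"
      proof eventually_elim
        case (elim N)
        then show ?case using diff[of N] by simp
      qed
      moreover have "closed {g :: (nat \<Rightarrow> real) \<Rightarrow> real. \<bar>g (\<lambda>n. a (Suc n)) - g a\<bar> \<le> \<epsilon>}"
        by (intro closed_Collect_le continuous_intros) auto
      ultimately show ?thesis using L by blast
    qed
    then show "L (\<lambda>n. a (Suc n)) = L a"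
      using field_le_epsilon[of "\<bar>L (\<lambda>n. a (Suc n)) - L a\<bar>" 0] by simp
  qed
  then show ?thesis by blast
qed

context banach_limit
begin

lemma diff: "Bseq a \<Longrightarrow> Bseq b \<Longrightarrow> L (\<lambda>n. a n - b n) = L a - L b"
  using add[of a "\<lambda>n. - 1 * b n"] scale[of b "-1"] Bseq_minus_iff[of b] by simp

lemma mono: 
  assumes "Bseq a" "Bseq b" "\<And>n. a n \<le> b n"
  shows "L a \<le> L b"
  using nonneg[of "\<lambda>n. b n - a n"] diff[of b a] Bseq_plus[of b "\<lambda>n. - a n"] Bseq_minus_iff[of a] assms
  by simp

lemma const: "L (\<lambda>n. c) = c"
  using scale[of "\<lambda>n. 1" c] const_one by simp

lemma shift_many: "Bseq a \<Longrightarrow> L (\<lambda>n. a (n + m)) = L a"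
proof (induction m)
  case (Suc m)
  have "Bseq (\<lambda>n. a (n + m))"
    using Suc.prems by (simp add: Bseq_ignore_initial_segment)
  from shift[OF this] show ?case
    using Suc by simp
qed simp

text \<open>
  After a shift the sequence lies between \<open>-\<epsilon>\<close> and \<open>\<epsilon>\<close>, and the shift does not change
  the value.
\<close>
lemma null:
  fixes a :: "nat \<Rightarrow> real"
  assumes "a \<longlonglongrightarrow> 0"
  shows "L a = 0"
proof -
  have a: "Bseq a"
    using assms convergent_imp_Bseq convergentI by blast
  have "\<bar>L a\<bar> \<le> \<epsilon>" if \<epsilon>: "\<epsilon> > 0" for \<epsilon>
  proof -
    obtain m where m: "\<And>n. n \<ge> m \<Longrightarrow> \<bar>a n\<bar> < \<epsilon>"
      using LIMSEQ_D[OF assms \<epsilon>] by (auto simp del: One_nat_def)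
    have "Bseq (\<lambda>n. a (n + m))"
      using a by (simp add: Bseq_ignore_initial_segment)
    moreover have "a (n + m) \<le> \<epsilon>" "- \<epsilon> \<le> a (n + m)" for n
      using m[of "n + m"] by (simp_all add: abs_less_iff)
    ultimately have "L (\<lambda>n. a (n + m)) \<le> \<epsilon>" "- \<epsilon> \<le> L (\<lambda>n. a (n + m))"
      using mono[of "\<lambda>n. a (n + m)" "\<lambda>n. \<epsilon>"] mono[of "\<lambda>n. - \<epsilon>" "\<lambda>n. a (n + m)"] 
      by (simp_all add: const)
    then show ?thesis
      using shift_many[OF a] by simp
  qed
  then show ?thesis
    using field_le_epsilon[of "\<bar>L a\<bar>" 0] by simp
qed

end

section \<open>Partial sums of the decreasing rearrangement\<close>

lemma bdd_above_abs:
  fixes x :: "nat \<Rightarrow> real"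
  assumes "bounded (range x)"
  shows "bdd_above ((\<lambda>k. \<bar>x k\<bar>) ` A)"
proof -
  obtain B where "\<And>k. \<bar>x k\<bar> \<le> B"
    using assms by (auto simp: bounded_iff)
  then show ?thesis
    by (intro bdd_aboveI2)
qed

lemma outside_finite_nonempty: "finite (J :: nat set) \<Longrightarrow> \<exists>k. k \<notin> J"
  by (rule ex_new_if_finite) simp

lemma decr_rearr_le:
  assumes "bounded (range x)" "finite J" "card J < n" "\<And>k. k \<notin> J \<Longrightarrow> \<bar>x k\<bar> \<le> c"
  shows "decr_rearr x n \<le> c"
proof -
  have "decr_rearr x n \<le> (SUP k\<in>UNIV - J. \<bar>x k\<bar>)"
    unfolding decr_rearr_def
  proof (rule cINF_lower)
    show "bdd_below ((\<lambda>J. SUP k\<in>UNIV - J. \<bar>x k\<bar>) ` {J. finite J \<and> card J < n})"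
    proof (rule bdd_belowI2)
      fix J :: "nat set" assume "J \<in> {J. finite J \<and> card J < n}"
      then obtain k where "k \<in> UNIV - J"
        using outside_finite_nonempty[of J] by auto
      then show "0 \<le> (SUP k\<in>UNIV - J. \<bar>x k\<bar>)"
        using bdd_above_abs[OF assms(1)] by (intro cSUP_upper2) auto
    qed
  qed (use assms in auto)
  also have "\<dots> \<le> c"
    using assms(4) outside_finite_nonempty[OF assms(2)] by (intro cSUP_least) auto
  finally show ?thesis .
qed

lemma le_decr_rearr:
  assumes "bounded (range x)" "n \<ge> 1"
    and "\<And>J. finite J \<Longrightarrow> card J < n \<Longrightarrow> \<exists>k. k \<notin> J \<and> c \<le> \<bar>x k\<bar>"
  shows "c \<le> decr_rearr x n"
  unfolding decr_rearr_def
proof (rule cINF_greatest)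
  show "{J. finite J \<and> card J < n} \<noteq> ({} :: nat set set)"
    using assms(2) by (auto intro!: exI[of _ "{}"])
  fix J :: "nat set" assume "J \<in> {J. finite J \<and> card J < n}"
  then obtain k where "k \<notin> J" "c \<le> \<bar>x k\<bar>"
    using assms(3) by auto
  then show "c \<le> (SUP k\<in>UNIV - J. \<bar>x k\<bar>)"
    using bdd_above_abs[OF assms(1)] by (intro cSUP_upper2) auto
qed

definition rearr_sum :: "(nat \<Rightarrow> real) \<Rightarrow> nat \<Rightarrow> real" where
  "rearr_sum x n = (\<Sum>k=1..n. decr_rearr x k)"

lemma rearr_sum_Suc: "rearr_sum x (Suc n) = rearr_sum x n + decr_rearr x (Suc n)"
  by (simp add: rearr_sum_def)

text \<open>
  Peel off the element of \<open>J\<close> where \<open>\<bar>x\<bar>\<close> is smallest.  A set with fewer elements than \<open>J\<close> misses some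
  point of \<open>J\<close>, so this smallest value is at most the last term of the rearrangement.
\<close>
lemma sum_le_rearr_sum_card:
  assumes "bounded (range x)" "finite J" "card J = n"
  shows "(\<Sum>k\<in>J. \<bar>x k\<bar>) \<le> rearr_sum x n"
  using assms(2,3)
proof (induction n arbitrary: J)
  case (Suc n)
  from Suc.prems have "finite ((\<lambda>k. \<bar>x k\<bar>) ` J)" "J \<noteq> {}" by auto
  then obtain j where j: "j \<in> J" "\<And>k. k \<in> J \<Longrightarrow> \<bar>x j\<bar> \<le> \<bar>x k\<bar>"
    using ex_min_if_finite[of "(\<lambda>k. \<bar>x k\<bar>) ` J"] by (auto simp: not_less)
  have "\<bar>x j\<bar> \<le> decr_rearr x (Suc n)"
  proof (rule le_decr_rearr)
    fix I :: "nat set" assume "finite I" "card I < Suc n"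
    then have "\<not> J \<subseteq> I"
      using Suc.prems card_mono[of I J] by auto
    then show "\<exists>k. k \<notin> I \<and> \<bar>x j\<bar> \<le> \<bar>x k\<bar>"
      using j by blast
  qed (use assms in auto)
  moreover have "(\<Sum>k\<in>J - {j}. \<bar>x k\<bar>) \<le> rearr_sum x n"
    using Suc.IH[of "J - {j}"] Suc.prems j(1) by simp
  ultimately show ?case
    using Suc.prems(1) j(1) by (simp add: rearr_sum_Suc sum.remove)
qed (simp add: rearr_sum_def)

lemma decr_rearr_nonneg: "bounded (range x) \<Longrightarrow> n \<ge> 1 \<Longrightarrow> 0 \<le> decr_rearr x n"
  using outside_finite_nonempty by (intro le_decr_rearr) auto

lemma rearr_sum_mono: "bounded (range x) \<Longrightarrow> m \<le> n \<Longrightarrow> rearr_sum x m \<le> rearr_sum x n"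
  unfolding rearr_sum_def by (rule sum_mono2) (auto simp: decr_rearr_nonneg)

lemma sum_le_rearr_sum:
  assumes "bounded (range x)" "finite J" "card J \<le> n"
  shows "(\<Sum>k\<in>J. \<bar>x k\<bar>) \<le> rearr_sum x n"
  using sum_le_rearr_sum_card[OF assms(1,2) refl] rearr_sum_mono[OF assms(1,3)] by linarith

lemma rearr_sum_nonneg: "bounded (range x) \<Longrightarrow> 0 \<le> rearr_sum x n"
  using sum_le_rearr_sum[of x "{}" n] by simp

text \<open>
  The suprema in the definition of the rearrangement need not be attained, hence the loss of
  \<open>\<epsilon>\<close> at each step of the greedy choice of \<open>J\<close>.
\<close>
lemma rearr_sum_approx:
  fixes \<epsilon> :: real
  assumes "bounded (range x)" "\<epsilon> > 0"
  shows "\<exists>J. finite J \<and> card J = n \<and> rearr_sum x n \<le> (\<Sum>k\<in>J. \<bar>x k\<bar>) + n * \<epsilon>"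
proof (induction n)
  case 0
  show ?case by (rule exI[of _ "{}"]) (simp add: rearr_sum_def)
next
  case (Suc n)
  then obtain J where J: "finite J" "card J = n" "rearr_sum x n \<le> (\<Sum>k\<in>J. \<bar>x k\<bar>) + n * \<epsilon>"
    by blast
  obtain k where k: "k \<notin> J" "decr_rearr x (Suc n) - \<epsilon> < \<bar>x k\<bar>"
  proof (rule ccontr)
    assume "\<not> thesis"
    then have "decr_rearr x (Suc n) \<le> decr_rearr x (Suc n) - \<epsilon>"
      using J(1,2) that assms(1) by (intro decr_rearr_le[of x J]) (auto simp flip: not_less)
    then show False using assms(2) by simp
  qed
  then show ?case
    using J by (intro exI[of _ "insert k J"]) (auto simp: rearr_sum_Suc algebra_simps)
qed

text \<open>
  The partial sums of the rearrangement as suprema over finite sets.  No ordering of the terms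
  enters this description, so sums, multiples and permutations of sequences are easy to treat.
\<close>
lemma rearr_sum_le_iff:
  assumes "bounded (range x)"
  shows "rearr_sum x n \<le> c \<longleftrightarrow> (\<forall>J. finite J \<longrightarrow> card J \<le> n \<longrightarrow> (\<Sum>k\<in>J. \<bar>x k\<bar>) \<le> c)"
proof (intro iffI allI impI)
  assume *: "\<forall>J. finite J \<longrightarrow> card J \<le> n \<longrightarrow> (\<Sum>k\<in>J. \<bar>x k\<bar>) \<le> c"
  show "rearr_sum x n \<le> c"
  proof (rule field_le_epsilon)
    fix \<epsilon> :: real assume "\<epsilon> > 0"
    then obtain J where "finite J" "card J = n" "rearr_sum x n \<le> (\<Sum>k\<in>J. \<bar>x k\<bar>) + real n * (\<epsilon> / Suc n)"
      using rearr_sum_approx[OF assms, where \<epsilon> = "\<epsilon> / Suc n" and n = n] by auto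
    moreover have "real n * (\<epsilon> / Suc n) \<le> \<epsilon>"
      using \<open>\<epsilon> > 0\<close> by (simp add: field_simps)
    ultimately show "rearr_sum x n \<le> c + \<epsilon>"
      using *[rule_format, of J] by simp
  qed
qed (use sum_le_rearr_sum[OF assms] in \<open>meson order_trans\<close>)

lemma rearr_sum_dominated:
  assumes "bounded (range y)" "\<And>k. \<bar>x k\<bar> \<le> \<bar>y k\<bar>"
  shows "bounded (range x)" "rearr_sum x n \<le> rearr_sum y n"
proof -
  show x: "bounded (range x)"
  proof -
    obtain B where "\<And>k. \<bar>y k\<bar> \<le> B"
      using assms(1) by (auto simp: bounded_iff)
    then have "\<bar>x k\<bar> \<le> B" for k
      using assms(2) order_trans by blast
    then show ?thesis
      by (auto simp: bounded_iff)
  qed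
  show "rearr_sum x n \<le> rearr_sum y n"
    unfolding rearr_sum_le_iff[OF x]
    using sum_le_rearr_sum[OF assms(1)] sum_mono[of _ "\<lambda>k. \<bar>x k\<bar>" "\<lambda>k. \<bar>y k\<bar>"] assms(2)
    by (meson order_trans)
qed

lemma rearr_sum_add_le:
  assumes "bounded (range x)" "bounded (range y)"
  shows "rearr_sum (\<lambda>k. x k + y k) n \<le> rearr_sum x n + rearr_sum y n"
proof -
  have "(\<Sum>k\<in>J. \<bar>x k + y k\<bar>) \<le> rearr_sum x n + rearr_sum y n" if "finite J" "card J \<le> n" for J
  proof -
    have "(\<Sum>k\<in>J. \<bar>x k + y k\<bar>) \<le> (\<Sum>k\<in>J. \<bar>x k\<bar>) + (\<Sum>k\<in>J. \<bar>y k\<bar>)"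
      unfolding sum.distrib[symmetric] by (intro sum_mono abs_triangle_ineq)
    then show ?thesis
      using sum_le_rearr_sum[OF assms(1) that] sum_le_rearr_sum[OF assms(2) that] by linarith
  qed
  then show ?thesis
    by (simp add: rearr_sum_le_iff bounded_plus_comp assms)
qed

text \<open>
  If \<open>I\<close> is nearly optimal for \<open>x\<close> and \<open>J\<close> for \<open>y\<close>, then \<open>I \<union> J\<close> is good for both, at the price of
  having up to \<open>2n\<close> elements.
\<close>
lemma rearr_sum_add_ge:
  assumes "bounded (range x)" "bounded (range y)" "\<And>k. 0 \<le> x k" "\<And>k. 0 \<le> y k"
  shows "rearr_sum x n + rearr_sum y n \<le> rearr_sum (\<lambda>k. x k + y k) (2 * n)"
proof -
  have "(\<Sum>k\<in>I. \<bar>x k\<bar>) + (\<Sum>k\<in>J. \<bar>y k\<bar>) \<le> rearr_sum (\<lambda>k. x k + y k) (2 * n)"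
    if "finite I" "card I \<le> n" "finite J" "card J \<le> n" for I J
  proof -
    have "(\<Sum>k\<in>I. \<bar>x k\<bar>) + (\<Sum>k\<in>J. \<bar>y k\<bar>) \<le> (\<Sum>k\<in>I \<union> J. \<bar>x k\<bar>) + (\<Sum>k\<in>I \<union> J. \<bar>y k\<bar>)"
      using that by (intro add_mono sum_mono2) auto
    also have "\<dots> = (\<Sum>k\<in>I \<union> J. \<bar>x k + y k\<bar>)"
      using assms(3,4) by (simp add: sum.distrib)
    also have "\<dots> \<le> rearr_sum (\<lambda>k. x k + y k) (2 * n)"
      using that card_Un_le[of I J] assms by (intro sum_le_rearr_sum bounded_plus_comp) auto
    finally show ?thesis .
  qed
  then have "rearr_sum x n \<le> rearr_sum (\<lambda>k. x k + y k) (2 * n) - (\<Sum>k\<in>J. \<bar>y k\<bar>)"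
    if "finite J" "card J \<le> n" for J
    using that unfolding rearr_sum_le_iff[OF assms(1)] by (simp add: le_diff_eq)
  then have "rearr_sum y n \<le> rearr_sum (\<lambda>k. x k + y k) (2 * n) - rearr_sum x n"
    unfolding rearr_sum_le_iff[OF assms(2)] by (simp add: algebra_simps)
  then show ?thesis by simp
qed

lemma rearr_sum_scale:
  assumes "bounded (range x)"
  shows "rearr_sum (\<lambda>k. c * x k) n = \<bar>c\<bar> * rearr_sum x n"
proof -
  have le: "rearr_sum (\<lambda>k. d * y k) n \<le> \<bar>d\<bar> * rearr_sum y n" 
    if "bounded (range y)" for d and y :: "nat \<Rightarrow> real"
    using that sum_le_rearr_sum[OF that]
    by (auto simp: rearr_sum_le_iff bounded_scaleR_comp[of y UNIV d, simplified] abs_mult 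
        sum_distrib_left[symmetric] mult_left_mono)
  \<comment> \<open>The reverse inequality is the same estimate for the factor \<open>1/c\<close>.\<close>
  show ?thesis
  proof (cases "c = 0")
    case True
    then show ?thesis
      using le[OF assms, of 0] rearr_sum_nonneg[of "\<lambda>k. 0" n] by simp
  next
    case False
    have "rearr_sum (\<lambda>k. inverse c * (c * x k)) n \<le> \<bar>inverse c\<bar> * rearr_sum (\<lambda>k. c * x k) n"
      by (intro le bounded_scaleR_comp[of x UNIV c, simplified] assms)
    then have "\<bar>c\<bar> * rearr_sum x n \<le> rearr_sum (\<lambda>k. c * x k) n"
      using False by (simp add: field_simps)
    then show ?thesis using le[OF assms, of c] by simp
  qed
qed

lemma rearr_sum_permute:
  assumes "bounded (range x)" "bij \<sigma>"
  shows "rearr_sum (x \<circ> \<sigma>) n = rearr_sum x n"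
proof -
  have le: "rearr_sum (y \<circ> \<tau>) n \<le> rearr_sum y n" 
    if y: "bounded (range y)" and \<tau>: "bij \<tau>" for y :: "nat \<Rightarrow> real" and \<tau>
  proof -
    have b: "bounded (range (y \<circ> \<tau>))"
      by (rule bounded_subset[OF y]) auto
    have "(\<Sum>k\<in>J. \<bar>(y \<circ> \<tau>) k\<bar>) \<le> rearr_sum y n" if "finite J" "card J \<le> n" for J
    proof -
      have "inj_on \<tau> J"
        using \<tau> by (meson bij_is_inj inj_on_subset subset_UNIV)
      then have "(\<Sum>k\<in>J. \<bar>(y \<circ> \<tau>) k\<bar>) = (\<Sum>k\<in>\<tau> ` J. \<bar>y k\<bar>)" "card (\<tau> ` J) = card J"
        by (simp_all add: sum.reindex card_image)
      then show ?thesis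
        using sum_le_rearr_sum[OF y, of "\<tau> ` J" n] that by simp
    qed
    then show ?thesis
      by (simp add: rearr_sum_le_iff[OF b])
  qed
  \<comment> \<open>The reverse inequality is the same estimate for the inverse permutation.\<close>
  have "rearr_sum ((x \<circ> \<sigma>) \<circ> inv \<sigma>) n \<le> rearr_sum (x \<circ> \<sigma>) n"
    using assms by (intro le bij_imp_bij_inv bounded_subset[OF assms(1)]) auto
  moreover have "(x \<circ> \<sigma>) \<circ> inv \<sigma> = x"
    using assms(2) by (simp add: fun_eq_iff bij_is_surj surj_f_inv_f)
  ultimately show ?thesis
    using le[OF assms] by simp
qed

lemma decr_rearr_decseq:
  assumes "decseq x" "\<And>k. 0 \<le> x k"
  shows "bounded (range x)" "decr_rearr x (Suc n) = x n"
proof -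
  have "\<bar>x k\<bar> \<le> x 0" for k
    using assms decseqD[OF assms(1), of 0 k] by simp
  then show b: "bounded (range x)"
    by (auto simp: bounded_iff)
  show "decr_rearr x (Suc n) = x n"
  proof (rule antisym)
    show "decr_rearr x (Suc n) \<le> x n"
      using assms decseqD[OF assms(1)] by (intro decr_rearr_le[OF b, of "{..<n}"]) auto
    show "x n \<le> decr_rearr x (Suc n)"
    proof (rule le_decr_rearr[OF b])
      fix J :: "nat set" assume "finite J" "card J < Suc n"
      then have "\<not> {..n} \<subseteq> J"
        using card_mono[of J "{..n}"] by auto
      then obtain k where "k \<notin> J" "k \<le> n" by auto
      then show "\<exists>k. k \<notin> J \<and> x n \<le> \<bar>x k\<bar>"
        using assms(2) decseqD[OF assms(1), of k n] by (intro exI[of _ k]) auto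
    qed simp
  qed
qed

lemma rearr_sum_decseq:
  assumes "decseq x" "\<And>k. 0 \<le> x k"
  shows "rearr_sum x n = (\<Sum>k<n. x k)"
  unfolding rearr_sum_def
  by (induction n) (simp_all add: decr_rearr_decseq(2)[OF assms])

section \<open>The Marcinkiewicz space\<close>

lemma marc_quot_eq: "marc_quot \<Psi> x n = rearr_sum x n / \<Psi> n"
  by (simp add: marc_quot_def rearr_sum_def)

lemma marc_space_iff:
  assumes "\<And>n. n \<ge> 1 \<Longrightarrow> 0 < \<Psi> n"
  shows "x \<in> marc_space \<Psi> \<longleftrightarrow>
    bounded (range x) \<and> (\<exists>C. \<forall>n\<ge>1. rearr_sum x n \<le> C * \<Psi> n)"
  using assms by (auto simp: marc_space_def bdd_above_def marc_quot_eq divide_le_eq)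

lemma rearr_sum_le_marc_norm:
  assumes "x \<in> marc_space \<Psi>" "n \<ge> 1"
  shows "rearr_sum x n / \<Psi> n \<le> marc_norm \<Psi> x"
  using assms cSUP_upper[of n "{1..}" "marc_quot \<Psi> x"]
  by (simp add: marc_space_def marc_norm_def marc_quot_eq)

section \<open>A sequence whose rearranged sums are comparable to \<open>\<Psi>\<close>\<close>

text \<open>
  Doubling \<open>n\<close> until \<open>m \<le> 2n\<close> never increases \<open>\<Psi>(n) / n\<close>; the last, incomplete step costs the factor
  \<open>2\<close>.
\<close>
lemma linear_growth_of_doubling:
  fixes \<Psi> :: "nat \<Rightarrow> real"
  assumes mono: "mono_on {1..} \<Psi>" and ge_1: "\<And>n. n \<ge> 1 \<Longrightarrow> 1 \<le> \<Psi> n"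
    and dbl: "\<And>n. n \<ge> N \<Longrightarrow> \<Psi> (2 * n) \<le> 2 * \<Psi> n"
    and "N \<ge> 1" "N \<le> n" "n \<le> m"
  shows "\<Psi> m \<le> 2 * (m / n) * \<Psi> n"
  using \<open>N \<le> n\<close> \<open>n \<le> m\<close>
proof (induction "m - n" arbitrary: n rule: less_induct)
  case less
  have n: "n \<ge> 1" "1 \<le> \<Psi> n"
    using less.prems \<open>N \<ge> 1\<close> ge_1[of n] by auto
  show ?case
  proof (cases "m \<le> 2 * n")
    case True
    have "\<Psi> m \<le> \<Psi> (2 * n)"
      using True n less.prems by (intro mono_onD[OF mono]) auto
    also have "\<dots> \<le> 2 * 1 * \<Psi> n"
      using dbl less.prems by simp
    also have "\<dots> \<le> 2 * (m / n) * \<Psi> n"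
      using n less.prems by (intro mult_right_mono mult_left_mono) (auto simp: field_simps)
    finally show ?thesis .
  next
    case False
    have "\<Psi> m \<le> 2 * (m / real (2 * n)) * \<Psi> (2 * n)"
      using False less.prems n by (intro less.hyps) auto
    also have "\<dots> \<le> 2 * (m / real (2 * n)) * (2 * \<Psi> n)"
      using dbl less.prems by (intro mult_left_mono) auto
    finally show ?thesis by (simp add: mult_ac)
  qed
qed

text \<open>
  The intercept \<open>b\<close> is required to be non-negative so that the majorants are bounded below also at
  \<open>0\<close>, where they are not compared with \<open>\<Psi>\<close>; the slope \<open>a\<close> is, so that their infimum increases.
\<close>
definition affine_majorants :: "(nat \<Rightarrow> real) \<Rightarrow> (real \<times> real) set" where
  "affine_majorants \<Psi> = {(a, b). 0 \<le> a \<and> 0 \<le> b \<and> (\<forall>m\<ge>1. \<Psi> m \<le> a * real m + b)}"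

definition concave_majorant :: "(nat \<Rightarrow> real) \<Rightarrow> nat \<Rightarrow> real" where
  "concave_majorant \<Psi> n = (INF (a, b)\<in>affine_majorants \<Psi>. a * real n + b)"

lemma concave_majorant_le:
  "(a, b) \<in> affine_majorants \<Psi> \<Longrightarrow> concave_majorant \<Psi> n \<le> a * real n + b"
  unfolding concave_majorant_def
  by (rule cINF_lower2[where x = "(a, b)"]) (auto intro!: bdd_belowI2[of _ 0] simp: affine_majorants_def)

lemma le_concave_majorant:
  assumes "affine_majorants \<Psi> \<noteq> {}"
    and "\<And>a b. (a, b) \<in> affine_majorants \<Psi> \<Longrightarrow> c \<le> a * real n + b"
  shows "c \<le> concave_majorant \<Psi> n"
  unfolding concave_majorant_def using assms by (intro cINF_greatest) auto

lemma concave_majorant_concave: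
  assumes "affine_majorants \<Psi> \<noteq> {}"
  shows "concave_majorant \<Psi> n + concave_majorant \<Psi> (Suc (Suc n)) \<le> 2 * concave_majorant \<Psi> (Suc n)"
proof -
  have "(concave_majorant \<Psi> n + concave_majorant \<Psi> (Suc (Suc n))) / 2 \<le> concave_majorant \<Psi> (Suc n)"
  proof (rule le_concave_majorant[OF assms])
    fix a b assume "(a, b) \<in> affine_majorants \<Psi>"
    from concave_majorant_le[OF this, of n] concave_majorant_le[OF this, of "Suc (Suc n)"]
    show "(concave_majorant \<Psi> n + concave_majorant \<Psi> (Suc (Suc n))) / 2 \<le> a * real (Suc n) + b"
      by (simp add: algebra_simps)
  qed
  then show ?thesis by simp
qed

lemma concave_majorant_mono:
  assumes "affine_majorants \<Psi> \<noteq> {}" "m \<le> n"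
  shows "concave_majorant \<Psi> m \<le> concave_majorant \<Psi> n"
proof (rule le_concave_majorant[OF assms(1)])
  fix a b assume ab: "(a, b) \<in> affine_majorants \<Psi>"
  have "a * real m + b \<le> a * real n + b"
    using ab assms(2) by (auto simp: affine_majorants_def mult_left_mono)
  then show "concave_majorant \<Psi> m \<le> a * real n + b"
    using concave_majorant_le[OF ab, of m] by linarith
qed

text \<open>
  The increments of the concave majorant decrease, so their rearranged sums telescope back to the
  majorant, up to its value \<open>c\<close> at \<open>0\<close>.
\<close>
lemma exists_rearr_sum_comparable:
  fixes \<Psi> :: "nat \<Rightarrow> real"
  assumes mono: "mono_on {1..} \<Psi>" and ge_1: "\<And>n. n \<ge> 1 \<Longrightarrow> 1 \<le> \<Psi> n"
    and dbl: "\<And>n. n \<ge> N \<Longrightarrow> \<Psi> (2 * n) \<le> 2 * \<Psi> n" and "N \<ge> 1"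
  obtains x c C where "bounded (range x)" "\<And>k. 0 \<le> x k"
    "\<And>n. n \<ge> 1 \<Longrightarrow> \<Psi> n - c \<le> rearr_sum x n" "\<And>n. n \<ge> 1 \<Longrightarrow> rearr_sum x n \<le> C * \<Psi> n"
proof -
  have maj: "(2 * \<Psi> n / n, \<Psi> n) \<in> affine_majorants \<Psi>" if "n \<ge> N" for n
  proof -
    have n: "n \<ge> 1" "1 \<le> \<Psi> n"
      using that \<open>N \<ge> 1\<close> ge_1[of n] by auto
    have "\<Psi> m \<le> 2 * \<Psi> n / n * real m + \<Psi> n" if "m \<ge> 1" for m
    proof (cases "m \<le> n")
      case True
      then have "\<Psi> m \<le> \<Psi> n"
        using \<open>m \<ge> 1\<close> n by (intro mono_onD[OF mono]) auto
      then show ?thesis using n by (simp add: add_increasing)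
    next
      case False
      then show ?thesis
        using linear_growth_of_doubling[OF mono ge_1 dbl \<open>N \<ge> 1\<close> \<open>n \<ge> N\<close>, of m] n by (simp add: mult_ac)
    qed
    then show ?thesis using n by (simp add: affine_majorants_def)
  qed
  then have ne: "affine_majorants \<Psi> \<noteq> {}" by blast
  define \<phi> where "\<phi> = concave_majorant \<Psi>"
  define x where "x k = \<phi> (Suc k) - \<phi> k" for k
  have nonneg: "0 \<le> x k" for k
    using concave_majorant_mono[OF ne, of k "Suc k"] by (simp add: x_def \<phi>_def)
  have "decseq x"
  proof (rule decseq_SucI)
    show "x (Suc n) \<le> x n" for n
      using concave_majorant_concave[OF ne, of n] by (simp add: x_def \<phi>_def)
  qed
  then have sum: "rearr_sum x n = \<phi> n - \<phi> 0" for n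
    using nonneg by (simp add: rearr_sum_decseq x_def sum_lessThan_telescope)
  have \<phi>0: "0 \<le> \<phi> 0"
    unfolding \<phi>_def by (rule le_concave_majorant[OF ne]) (simp add: affine_majorants_def)
  have large: "\<phi> n \<le> 3 * \<Psi> n" if "n \<ge> N" for n
    using concave_majorant_le[OF maj[OF that], of n] that \<open>N \<ge> 1\<close> by (simp add: \<phi>_def)
  show thesis
  proof (rule that)
    show "bounded (range x)"
      using decr_rearr_decseq(1)[OF \<open>decseq x\<close>] nonneg by blast
    show "0 \<le> x k" for k by (rule nonneg)
    show "\<Psi> n - \<phi> 0 \<le> rearr_sum x n" if "n \<ge> 1" for n
    proof -
      have "\<Psi> n \<le> \<phi> n"
        unfolding \<phi>_def using that by (intro le_concave_majorant[OF ne]) (simp add: affine_majorants_def)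
      then show ?thesis by (simp add: sum)
    qed
    show "rearr_sum x n \<le> 3 * \<Psi> N * \<Psi> n" if "n \<ge> 1" for n
    proof -
      have pos: "1 \<le> \<Psi> N" "1 \<le> \<Psi> n"
        using ge_1 that \<open>N \<ge> 1\<close> by auto
      have "\<phi> n \<le> 3 * \<Psi> N * \<Psi> n"
      proof (cases "N \<le> n")
        case True
        have "3 * 1 * \<Psi> n \<le> 3 * \<Psi> N * \<Psi> n"
          using pos by (intro mult_right_mono mult_left_mono) auto
        then show ?thesis
          using large[OF True] by simp
      next
        \<comment> \<open>Below \<open>N\<close> the monotonicity of the majorant and \<open>1 \<le> \<Psi> n\<close> suffice.\<close>
        case False
        then have "\<phi> n \<le> 3 * \<Psi> N * 1"
          using concave_majorant_mono[OF ne, of n N] large[of N] by (simp add: \<phi>_def)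
        also have "\<dots> \<le> 3 * \<Psi> N * \<Psi> n"
          using pos by (intro mult_left_mono) auto
        finally show ?thesis .
      qed
      then show ?thesis
        using \<phi>0 by (simp add: sum)
    qed
  qed
qed

section \<open>The Dixmier trace\<close>

locale dixmier = banach_limit +
  fixes \<Psi> :: "nat \<Rightarrow> real"
  assumes Psi_ge_1: "\<And>n. n \<ge> 1 \<Longrightarrow> 1 \<le> \<Psi> n"
    and Psi_doubling: "(\<lambda>i. \<Psi> (2 ^ Suc i) / \<Psi> (2 ^ i)) \<longlonglongrightarrow> 1"
begin

lemma Psi_pos: "n \<ge> 1 \<Longrightarrow> 0 < \<Psi> n"
  using Psi_ge_1[of n] by simp

lemma space_iff:
  "x \<in> marc_space \<Psi> \<longleftrightarrow>
    bounded (range x) \<and> (\<exists>C. \<forall>n\<ge>1. rearr_sum x n \<le> C * \<Psi> n)"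
  by (rule marc_space_iff) (rule Psi_pos)

lemma space_bounded: "x \<in> marc_space \<Psi> \<Longrightarrow> bounded (range x)"
  by (simp add: marc_space_def)

lemma space_add:
  assumes "x \<in> marc_space \<Psi>" "y \<in> marc_space \<Psi>"
  shows "(\<lambda>k. x k + y k) \<in> marc_space \<Psi>"
proof -
  obtain C D where "\<And>n. n \<ge> 1 \<Longrightarrow> rearr_sum x n \<le> C * \<Psi> n" "\<And>n. n \<ge> 1 \<Longrightarrow> rearr_sum y n \<le> D * \<Psi> n"
    using assms by (auto simp: space_iff)
  then have "rearr_sum (\<lambda>k. x k + y k) n \<le> (C + D) * \<Psi> n" if "n \<ge> 1" for n
    using rearr_sum_add_le[OF assms[THEN space_bounded], of n] that
    by (fastforce simp: algebra_simps)
  then show ?thesis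
    using assms by (auto simp: space_iff intro!: bounded_plus_comp)
qed

lemma space_dominated:
  assumes "y \<in> marc_space \<Psi>" "\<And>k. \<bar>x k\<bar> \<le> \<bar>y k\<bar>"
  shows "x \<in> marc_space \<Psi>"
proof -
  obtain C where "\<And>n. n \<ge> 1 \<Longrightarrow> rearr_sum y n \<le> C * \<Psi> n"
    using assms(1) by (auto simp: space_iff)
  then have "rearr_sum x n \<le> C * \<Psi> n" if "n \<ge> 1" for n
    using rearr_sum_dominated(2)[OF space_bounded[OF assms(1)] assms(2)] that order_trans by blast
  then show ?thesis
    using rearr_sum_dominated(1)[OF space_bounded[OF assms(1)] assms(2)] by (auto simp: space_iff)
qed

lemma space_scale:
  assumes "x \<in> marc_space \<Psi>"
  shows "(\<lambda>k. c * x k) \<in> marc_space \<Psi>"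
proof -
  obtain C where C: "\<And>n. n \<ge> 1 \<Longrightarrow> rearr_sum x n \<le> C * \<Psi> n"
    using assms by (auto simp: space_iff)
  have "rearr_sum (\<lambda>k. c * x k) n \<le> \<bar>c\<bar> * C * \<Psi> n" if "n \<ge> 1" for n
    using mult_left_mono[OF C[OF that], of "\<bar>c\<bar>"]
    by (simp add: rearr_sum_scale[OF space_bounded[OF assms]] mult_ac)
  then show ?thesis
    using bounded_scaleR_comp[of x UNIV c] assms by (auto simp: space_iff)
qed

definition dyadic_quot :: "(nat \<Rightarrow> real) \<Rightarrow> nat \<Rightarrow> real" where
  "dyadic_quot x i = rearr_sum x (2 ^ i) / \<Psi> (2 ^ i)"

lemma dyadic_quot_nonneg: "x \<in> marc_space \<Psi> \<Longrightarrow> 0 \<le> dyadic_quot x i"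
  using rearr_sum_nonneg[OF space_bounded, of x "2 ^ i"] Psi_pos[of "2 ^ i"]
  by (simp add: dyadic_quot_def)

lemma dyadic_quot_le: "x \<in> marc_space \<Psi> \<Longrightarrow> dyadic_quot x i \<le> marc_norm \<Psi> x"
  using rearr_sum_le_marc_norm[of x \<Psi> "2 ^ i"] by (simp add: dyadic_quot_def)

lemma Bseq_dyadic_quot: "x \<in> marc_space \<Psi> \<Longrightarrow> Bseq (dyadic_quot x)"
  using dyadic_quot_nonneg dyadic_quot_le by (intro BseqI'[of _ "marc_norm \<Psi> x"]) auto

text \<open>
  The trace on the positive cone.  On a signed sequence the rearrangement sees only \<open>\<bar>x\<bar>\<close>, so there it
  gives the trace of \<open>\<bar>x\<bar>\<close>.
\<close>
definition pos_trace :: "(nat \<Rightarrow> real) \<Rightarrow> real" where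
  "pos_trace x = L (dyadic_quot x)"

lemma pos_trace_add_le:
  assumes "x \<in> marc_space \<Psi>" "y \<in> marc_space \<Psi>"
  shows "pos_trace (\<lambda>k. x k + y k) \<le> pos_trace x + pos_trace y"
proof -
  have "dyadic_quot (\<lambda>k. x k + y k) i \<le> dyadic_quot x i + dyadic_quot y i" for i
    using rearr_sum_add_le[OF assms[THEN space_bounded], of "2 ^ i"] Psi_pos[of "2 ^ i"]
    by (simp add: dyadic_quot_def add_divide_distrib[symmetric] divide_right_mono)
  then have "L (dyadic_quot (\<lambda>k. x k + y k)) \<le> L (\<lambda>i. dyadic_quot x i + dyadic_quot y i)"
    using assms by (intro mono Bseq_plus Bseq_dyadic_quot space_add)
  then show ?thesis
    using assms by (simp add: pos_trace_def add Bseq_dyadic_quot)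
qed

text \<open>
  With \<open>a\<close> the dyadic quotients of \<open>x + y\<close> and \<open>r i = \<Psi>(2 ^ (i+1)) / \<Psi>(2 ^ i)\<close>, the superadditivity of
  the rearranged sums reads as follows: the dyadic quotients of \<open>x\<close> and \<open>y\<close> add up to at most
  \<open>a (i+1) * r i\<close>.  This is the shifted sequence \<open>a\<close> up to a null sequence, since \<open>r\<close> tends to \<open>1\<close>, and
  a Banach limit sees neither the shift nor the null sequence.
\<close>
lemma pos_trace_add_ge:
  assumes "x \<in> marc_space \<Psi>" "y \<in> marc_space \<Psi>" "\<And>k. 0 \<le> x k" "\<And>k. 0 \<le> y k"
  shows "pos_trace x + pos_trace y \<le> pos_trace (\<lambda>k. x k + y k)"
proof -
  define a where "a = dyadic_quot (\<lambda>k. x k + y k)"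
  define r where "r i = \<Psi> (2 ^ Suc i) / \<Psi> (2 ^ i)" for i
  define e where "e i = a (Suc i) * (r i - 1)" for i
  have a: "Bseq a"
    using assms by (simp add: a_def Bseq_dyadic_quot space_add)
  then obtain B where B: "\<And>i. \<bar>a i\<bar> \<le> B"
    by (auto simp: Bseq_def)
  have a': "Bseq (\<lambda>i. a (Suc i))"
    using B by (intro BseqI'[of _ B]) auto
  have "(\<lambda>i. B * \<bar>r i - 1\<bar>) \<longlonglongrightarrow> 0"
    using Psi_doubling unfolding r_def
    by (intro tendsto_mult_right_zero tendsto_rabs_zero LIM_zero)
  then have e: "e \<longlonglongrightarrow> 0"
    by (rule Lim_null_comparison[rotated])
      (auto simp: e_def abs_mult B intro!: always_eventually mult_right_mono)
  then have e': "Bseq e"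
    using convergent_imp_Bseq convergentI by blast
  have "dyadic_quot x i + dyadic_quot y i \<le> a (Suc i) + e i" for i
  proof -
    have "dyadic_quot x i + dyadic_quot y i \<le> rearr_sum (\<lambda>k. x k + y k) (2 ^ Suc i) / \<Psi> (2 ^ i)"
      using rearr_sum_add_ge[OF assms(1,2)[THEN space_bounded] assms(3,4), of "2 ^ i"] Psi_pos[of "2 ^ i"]
      by (simp add: dyadic_quot_def add_divide_distrib[symmetric] divide_right_mono)
    also have "\<dots> = a (Suc i) * r i"
      using Psi_pos[of "2 ^ Suc i"] by (simp add: a_def r_def dyadic_quot_def)
    finally show ?thesis
      by (simp add: e_def algebra_simps)
  qed
  then have "L (\<lambda>i. dyadic_quot x i + dyadic_quot y i) \<le> L (\<lambda>i. a (Suc i) + e i)"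
    using assms a' e' by (intro mono Bseq_plus Bseq_dyadic_quot)
  also have "\<dots> = L a"
    using a a' e e' by (simp add: add shift null)
  finally show ?thesis
    using assms by (simp add: pos_trace_def a_def add Bseq_dyadic_quot)
qed

lemma pos_trace_add:
  assumes "x \<in> marc_space \<Psi>" "y \<in> marc_space \<Psi>" "\<And>k. 0 \<le> x k" "\<And>k. 0 \<le> y k"
  shows "pos_trace (\<lambda>k. x k + y k) = pos_trace x + pos_trace y"
  using pos_trace_add_le[OF assms(1,2)] pos_trace_add_ge[OF assms] by simp

lemma pos_trace_scale:
  assumes "x \<in> marc_space \<Psi>"
  shows "pos_trace (\<lambda>k. c * x k) = \<bar>c\<bar> * pos_trace x"
proof -
  have "dyadic_quot (\<lambda>k. c * x k) = (\<lambda>i. \<bar>c\<bar> * dyadic_quot x i)"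
    using rearr_sum_scale[OF space_bounded[OF assms]] by (auto simp: dyadic_quot_def)
  then show ?thesis
    using assms by (simp add: pos_trace_def scale Bseq_dyadic_quot)
qed

lemma pos_trace_nonneg: "x \<in> marc_space \<Psi> \<Longrightarrow> 0 \<le> pos_trace x"
  unfolding pos_trace_def by (intro nonneg Bseq_dyadic_quot dyadic_quot_nonneg)

lemma pos_trace_le_norm:
  assumes "x \<in> marc_space \<Psi>" "\<And>k. \<bar>u k\<bar> \<le> \<bar>x k\<bar>"
  shows "pos_trace u \<le> marc_norm \<Psi> x"
proof -
  have u: "u \<in> marc_space \<Psi>"
    using assms by (rule space_dominated)
  have "dyadic_quot u i \<le> dyadic_quot x i" for i
    using rearr_sum_dominated(2)[OF space_bounded[OF assms(1)] assms(2), of "2 ^ i"] Psi_pos[of "2 ^ i"]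
    by (simp add: dyadic_quot_def divide_right_mono)
  then have "L (dyadic_quot u) \<le> L (\<lambda>i. marc_norm \<Psi> x)"
    using dyadic_quot_le[OF assms(1)] u
    by (intro mono Bseq_dyadic_quot) (auto intro: order_trans)
  then show ?thesis
    by (simp add: pos_trace_def const)
qed

definition trace :: "(nat \<Rightarrow> real) \<Rightarrow> real" where
  "trace x = pos_trace (\<lambda>k. max (x k) 0) - pos_trace (\<lambda>k. max (- x k) 0)"

text \<open>
  Any decomposition into non-negative sequences gives the trace; linearity follows by adding or
  scaling decompositions.
\<close>
lemma trace_eq:
  assumes "u \<in> marc_space \<Psi>" "v \<in> marc_space \<Psi>" "\<And>k. 0 \<le> u k" "\<And>k. 0 \<le> v k"
    and "\<And>k. x k = u k - v k"
  shows "trace x = pos_trace u - pos_trace v"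
proof -
  have "(\<lambda>k. max (x k) 0) \<in> marc_space \<Psi>"
    using assms(3-) by (intro space_dominated[OF assms(1)]) auto
  moreover have "(\<lambda>k. max (- x k) 0) \<in> marc_space \<Psi>"
    using assms(3-) by (intro space_dominated[OF assms(2)]) auto
  ultimately have "pos_trace (\<lambda>k. max (x k) 0 + v k) = pos_trace (\<lambda>k. max (x k) 0) + pos_trace v"
    "pos_trace (\<lambda>k. max (- x k) 0 + u k) = pos_trace (\<lambda>k. max (- x k) 0) + pos_trace u"
    using assms by (auto intro!: pos_trace_add)
  moreover have "(\<lambda>k. max (x k) 0 + v k) = (\<lambda>k. max (- x k) 0 + u k)"
    using assms(5) by (auto simp: max_def)
  ultimately show ?thesis
    by (simp add: trace_def)
qed

lemma pos_neg_in_space: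
  assumes "x \<in> marc_space \<Psi>"
  shows "(\<lambda>k. max (x k) 0) \<in> marc_space \<Psi>" "(\<lambda>k. max (- x k) 0) \<in> marc_space \<Psi>"
  by (auto intro!: space_dominated[OF assms])

lemma trace_add:
  assumes "x \<in> marc_space \<Psi>" "y \<in> marc_space \<Psi>"
  shows "trace (\<lambda>k. x k + y k) = trace x + trace y"
proof -
  note parts = pos_neg_in_space[OF assms(1)] pos_neg_in_space[OF assms(2)]
  have "trace (\<lambda>k. x k + y k) =
    pos_trace (\<lambda>k. max (x k) 0 + max (y k) 0) - pos_trace (\<lambda>k. max (- x k) 0 + max (- y k) 0)"
    using parts by (intro trace_eq space_add) auto
  then show ?thesis
    using parts by (simp add: pos_trace_add trace_def)
qed

lemma trace_scale:
  assumes "x \<in> marc_space \<Psi>"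
  shows "trace (\<lambda>k. c * x k) = c * trace x"
proof -
  note parts = pos_neg_in_space[OF assms]
  show ?thesis
  proof (cases "c \<ge> 0")
    case True
    have "trace (\<lambda>k. c * x k) =
      pos_trace (\<lambda>k. c * max (x k) 0) - pos_trace (\<lambda>k. c * max (- x k) 0)"
      using parts True by (intro trace_eq space_scale) (auto simp: max_def)
    then show ?thesis
      using parts True by (simp add: pos_trace_scale trace_def right_diff_distrib)
  next
    \<comment> \<open>A negative factor interchanges the positive and the negative part.\<close>
    case False
    have "trace (\<lambda>k. c * x k) =
      pos_trace (\<lambda>k. - c * max (- x k) 0) - pos_trace (\<lambda>k. - c * max (x k) 0)"
      using parts False by (intro trace_eq space_scale) (auto simp: max_def mult_nonpos_nonneg)
    also have "\<dots> = c * trace x"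
      using False by (simp only: pos_trace_scale[OF parts(1)] pos_trace_scale[OF parts(2)] trace_def)
        (simp add: algebra_simps)
    finally show ?thesis .
  qed
qed

lemma abs_trace_le_norm:
  assumes "x \<in> marc_space \<Psi>"
  shows "\<bar>trace x\<bar> \<le> marc_norm \<Psi> x"
proof -
  have "pos_trace (\<lambda>k. max (x k) 0) \<le> marc_norm \<Psi> x" "pos_trace (\<lambda>k. max (- x k) 0) \<le> marc_norm \<Psi> x"
    by (intro pos_trace_le_norm[OF assms]; auto)+
  then show ?thesis
    using pos_neg_in_space[OF assms, THEN pos_trace_nonneg] by (simp add: trace_def abs_le_iff)
qed

lemma marc_linear_trace: "marc_linear \<Psi> trace"
  by (simp add: marc_linear_def trace_add trace_scale)

lemma marc_continuous_trace: "marc_continuous \<Psi> trace"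
  unfolding marc_continuous_def
proof (intro ballI allI impI)
  fix x \<epsilon> assume x: "x \<in> marc_space \<Psi>" and "(\<epsilon>::real) > 0"
  have "\<bar>trace y - trace x\<bar> < \<epsilon>"
    if y: "y \<in> marc_space \<Psi>" and lt: "marc_norm \<Psi> (\<lambda>k. y k - x k) < \<epsilon>" for y
  proof -
    have "(\<lambda>k. y k + (- 1) * x k) \<in> marc_space \<Psi>"
      using x y by (intro space_add space_scale)
    moreover have "trace (\<lambda>k. y k + (- 1) * x k) = trace y - trace x"
      using x y by (simp only: trace_add[OF y space_scale[OF x]] trace_scale[OF x])
    ultimately show ?thesis
      using abs_trace_le_norm lt by fastforce
  qed
  then show "\<exists>\<delta>>0. \<forall>y\<in>marc_space \<Psi>. marc_norm \<Psi> (\<lambda>k. y k - x k) < \<delta> \<longrightarrow> \<bar>trace y - trace x\<bar> < \<epsilon>"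
    using \<open>\<epsilon> > 0\<close> by blast
qed

lemma marc_symmetric_trace: "marc_symmetric \<Psi> trace"
  unfolding marc_symmetric_def
proof (intro ballI allI impI)
  fix x and \<sigma> :: "nat \<Rightarrow> nat" assume x: "x \<in> marc_space \<Psi>" and \<sigma>: "bij \<sigma>"
  have perm: "pos_trace (u \<circ> \<sigma>) = pos_trace u" if "u \<in> marc_space \<Psi>" for u
    using rearr_sum_permute[OF space_bounded[OF that] \<sigma>] by (simp add: pos_trace_def dyadic_quot_def[abs_def])
  from pos_neg_in_space[OF x, THEN perm] show "trace x = trace (x \<circ> \<sigma>)"
    by (simp add: trace_def comp_def)
qed

text \<open>
  The dyadic quotients are at least \<open>1 - c / \<Psi>(2 ^ i)\<close>, and the error is a null sequence.
\<close>
lemma trace_ge_1: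
  assumes "filterlim \<Psi> at_top sequentially" "x \<in> marc_space \<Psi>" "\<And>k. 0 \<le> x k"
    and lower: "\<And>n. n \<ge> 1 \<Longrightarrow> \<Psi> n - c \<le> rearr_sum x n"
  shows "1 \<le> trace x"
proof -
  have "filterlim (\<lambda>i. \<Psi> (2 ^ i)) at_top sequentially"
    by (rule filterlim_compose[OF assms(1)], rule filterlim_subseq) (simp add: strict_mono_def)
  then have lim: "(\<lambda>i. c / \<Psi> (2 ^ i)) \<longlonglongrightarrow> 0"
    by (intro tendsto_divide_0[OF tendsto_const] filterlim_at_top_imp_at_infinity)
  then have b: "Bseq (\<lambda>i. c / \<Psi> (2 ^ i))"
    using convergent_imp_Bseq convergentI by blast
  have "1 \<le> dyadic_quot x i + c / \<Psi> (2 ^ i)" for i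
    using lower[of "2 ^ i"] Psi_pos[of "2 ^ i"] by (simp add: dyadic_quot_def field_simps)
  then have "L (\<lambda>i. 1) \<le> L (\<lambda>i. dyadic_quot x i + c / \<Psi> (2 ^ i))"
    using assms(2) b by (intro mono Bseq_plus Bseq_dyadic_quot) auto
  also have "\<dots> = pos_trace x"
    using assms(2) b lim by (simp add: add Bseq_dyadic_quot null pos_trace_def)
  also have "\<dots> = trace x"
  proof -
    have "trace x = pos_trace x - pos_trace (\<lambda>k. 0 * x k)"
      using assms(2,3) by (intro trace_eq space_scale) auto
    also have "pos_trace (\<lambda>k. 0 * x k) = 0"
      using pos_trace_scale[OF assms(2), of 0] by simp
    finally show ?thesis by simp
  qed
  finally show ?thesis
    by (simp add: const)
qed

end

theorem proposition3p5:
  fixes \<Psi> :: "nat \<Rightarrow> real"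
  assumes "\<Psi> 1 = 1"
    and "mono_on {1..} \<Psi>"
    and "filterlim \<Psi> at_top sequentially"
    and "(\<lambda>n. \<Psi> n / real n) \<longlonglongrightarrow> 0"
    and "(\<lambda>n. \<Psi> (2 * n) / \<Psi> n) \<longlonglongrightarrow> 1"
  shows "\<exists>\<gamma> :: (nat \<Rightarrow> real) \<Rightarrow> real.
           marc_linear \<Psi> \<gamma> \<and> marc_continuous \<Psi> \<gamma> \<and> marc_symmetric \<Psi> \<gamma> \<and>
           (\<exists>x\<in>marc_space \<Psi>. \<gamma> x \<noteq> 0)"
proof -
  obtain L where L: "banach_limit L"
    using banach_limit_exists by blast
  have ge_1: "1 \<le> \<Psi> n" if "n \<ge> 1" for n
    using mono_onD[OF assms(2), of 1 n] that assms(1) by simp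
  have "(\<lambda>i. \<Psi> (2 * 2 ^ i) / \<Psi> (2 ^ i)) \<longlonglongrightarrow> 1"
    using filterlim_compose[OF assms(5), of "\<lambda>i. 2 ^ i" sequentially]
    by (simp add: filterlim_subseq strict_mono_def)
  then interpret dixmier L \<Psi>
    using L ge_1 by (simp add: dixmier_def dixmier_axioms_def)
  have "eventually (\<lambda>n. \<Psi> (2 * n) / \<Psi> n < 2) sequentially"
    using assms(5) by (rule order_tendstoD) simp
  then obtain N where N: "\<And>n. n \<ge> N \<Longrightarrow> \<Psi> (2 * n) / \<Psi> n < 2"
    by (auto simp: eventually_sequentially)
  have dbl: "\<Psi> (2 * n) \<le> 2 * \<Psi> n" if "n \<ge> max N 1" for n
    using N[of n] Psi_pos[of n] that by (simp add: divide_less_eq)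
  obtain x c C where x: "bounded (range x)" "\<And>k. 0 \<le> x k"
    "\<And>n. n \<ge> 1 \<Longrightarrow> \<Psi> n - c \<le> rearr_sum x n" "\<And>n. n \<ge> 1 \<Longrightarrow> rearr_sum x n \<le> C * \<Psi> n"
    using exists_rearr_sum_comparable[OF assms(2) ge_1 dbl] by (metis max.cobounded2)
  have mem: "x \<in> marc_space \<Psi>"
    using x by (auto simp: space_iff)
  have "trace x \<noteq> 0"
    using trace_ge_1[OF assms(3) mem x(2,3)] by simp
  then show ?thesis
    using mem marc_linear_trace marc_continuous_trace marc_symmetric_trace by blast
qed

end
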